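(* Let $\pi$ be a set of primes such that $E_\pi\setminus C_\pi\neq\varnothing$, i.e. there is a finite group that lies in $E_\pi$ but not in $C_\pi$. Then there exist a finite group $G\in E_\pi\setminus C_\pi$ and a $\pi$-Hall subgroup $H$ of $G$ such that $H$ is not pronormal in $G$.
   Context: All groups are finite. Let $\pi$ be a set of primes. A $\pi$-group is a finite group all of whose order's prime divisors lie in $\pi$. A subgroup $H$ of $G$ is a $\pi$-Hall subgroup if $H$ is a $\pi$-group and the index $|G:H|$ is not divisible by any prime in $\pi$. $E_\pi$ is the class of finite groups possessing a $\pi$-Hall subgroup; $C_\pi$ is the class of finite groups $G\in E_\pi$ in which every two $\pi$-Hall subgroups are conjugate in $G$. A subgroup $H$ of $G$ is pronormal if, for every $g\in G$, the subgroups $H$ and $H^g=g^{-1}Hg$ are conjugate in $\langle H,H^g\rangle$. *)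

theory Defs
  imports "HOL-Algebra.Generated_Groups" "HOL-Computational_Algebra.Primes"
begin

definition pi_group :: "nat set \<Rightarrow> ('a, 'b) monoid_scheme \<Rightarrow> bool" where
  "pi_group \<pi> G \<longleftrightarrow>
     group G \<and> finite (carrier G) \<and> (\<forall>p. prime p \<and> p dvd order G \<longrightarrow> p \<in> \<pi>)"

definition hall_subgroup :: "nat set \<Rightarrow> ('a, 'b) monoid_scheme \<Rightarrow> 'a set \<Rightarrow> bool" where
  "hall_subgroup \<pi> G H \<longleftrightarrow>
     subgroup H G \<and> pi_group \<pi> (G\<lparr>carrier := H\<rparr>) \<and>
     (\<forall>p\<in>\<pi>. \<not> p dvd card (rcosets\<^bsub>G\<^esub> H))"

definition conj_subgroup :: "('a, 'b) monoid_scheme \<Rightarrow> 'a set \<Rightarrow> 'a \<Rightarrow> 'a set" where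
  "conj_subgroup G H g = (\<lambda>h. inv\<^bsub>G\<^esub> g \<otimes>\<^bsub>G\<^esub> h \<otimes>\<^bsub>G\<^esub> g) ` H"

text \<open>\<open>conjugate_in G K A B\<close>: the subsets \<open>A\<close> and \<open>B\<close> of \<open>G\<close> are conjugate by an element of \<open>K\<close>.\<close>

definition conjugate_in :: "('a, 'b) monoid_scheme \<Rightarrow> 'a set \<Rightarrow> 'a set \<Rightarrow> 'a set \<Rightarrow> bool" where
  "conjugate_in G K A B \<longleftrightarrow> (\<exists>x\<in>K. B = conj_subgroup G A x)"

definition pronormal :: "('a, 'b) monoid_scheme \<Rightarrow> 'a set \<Rightarrow> bool" where
  "pronormal G H \<longleftrightarrow>
     subgroup H G \<and>
     (\<forall>g\<in>carrier G.
        conjugate_in G (generate G (H \<union> conj_subgroup G H g)) H (conj_subgroup G H g))"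

text \<open>
  The classes \<open>E\<^sub>\<pi>\<close> and \<open>C\<^sub>\<pi>\<close>, restricted to groups whose elements have type \<open>'a\<close>. Every finite
  group has an isomorphic copy with elements of type \<^typ>\<open>nat\<close>, so
  \<open>E_class \<pi> :: nat monoid set\<close> represents the whole class up to isomorphism.
\<close>

definition E_class :: "nat set \<Rightarrow> 'a monoid set" where
  "E_class \<pi> = {G. group G \<and> finite (carrier G) \<and> (\<exists>H. hall_subgroup \<pi> G H)}"

definition C_class :: "nat set \<Rightarrow> 'a monoid set" where
  "C_class \<pi> = {G \<in> E_class \<pi>. \<forall>H K. hall_subgroup \<pi> G H \<and> hall_subgroup \<pi> G K \<longrightarrow>
                  conjugate_in G (carrier G) H K}"

end

theory Submission
  imports Defs "HOL-Algebra.Weak_Morphisms"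
begin

text \<open>
  Let \<open>H\<close> and \<open>K\<close> be non-conjugate \<open>\<pi>\<close>-Hall subgroups of \<open>X\<close>. Then \<open>\<pi>\<close> omits some prime \<open>p\<close>, since
  otherwise \<open>H = X = K\<close>. In the wreath product \<open>X \<wr> \<int>/p\<close> every product of \<open>p\<close> factors taken from
  \<open>{H, K}\<close> is a \<open>\<pi>\<close>-Hall subgroup, contained in the base \<open>X\<^sup>p\<close>. The subgroup \<open>L = H \<times> K \<times> \<dots> \<times> K\<close>
  and its translate \<open>L\<^sup>g\<close> by a cyclic shift \<open>g\<close> lie in the base and have factors \<open>H\<close> and \<open>K\<close> in the
  same coordinate, so they are not conjugate in \<open>\<langle>L, L\<^sup>g\<rangle>\<close>. The subgroups \<open>H\<^sup>p\<close> and \<open>L\<close> are not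
  conjugate at all, because \<open>H\<^sup>p\<close> is invariant under shifts.
\<close>

subsection \<open>Hall subgroups and conjugation\<close>

text \<open>Removes the inverse, so that conjugation in the wreath product can be checked by
  multiplying alone, with no formula for the inverse of an element with nonzero shift.\<close>

lemma (in group) conj_eq_iff_commute:
  assumes "x \<in> carrier G" "y \<in> carrier G" "g \<in> carrier G"
  shows "inv g \<otimes> x \<otimes> g = y \<longleftrightarrow> x \<otimes> g = g \<otimes> y"
  using assms by (metis inv_closed m_assoc m_closed inv_solve_left)

lemma (in group) conj_subgroup_subset:
  assumes "A \<subseteq> carrier G" "g \<in> carrier G"
  shows "conj_subgroup G A g \<subseteq> carrier G"
  using assms unfolding conj_subgroup_def by auto

lemma (in group) conj_subgroup_one:
  assumes "A \<subseteq> carrier G"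
  shows "conj_subgroup G A \<one> = A"
proof -
  have "inv \<one> \<otimes> h \<otimes> \<one> = h" if "h \<in> A" for h
    using assms that by auto
  then show ?thesis
    unfolding conj_subgroup_def by simp
qed

text \<open>By Lagrange and \<open>card H > 0\<close>, the cofactor \<open>m\<close> can only be the
  index. This turns the Hall property into arithmetic of orders, which is easy to compute for
  products and to carry along isomorphisms.\<close>

lemma (in group) hall_subgroup_iff:
  assumes "finite (carrier G)"
  shows "hall_subgroup \<pi> G H \<longleftrightarrow> subgroup H G \<and> (\<forall>p. prime p \<and> p dvd card H \<longrightarrow> p \<in> \<pi>) \<and>
           (\<exists>m. order G = card H * m \<and> (\<forall>p\<in>\<pi>. \<not> p dvd m))"
proof (cases "subgroup H G")
  case True
  have fin: "finite H"
    using True assms finite_subset subgroup.subset by blast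
  have "card H > 0"
    using fin subgroup.one_closed[OF True] by (auto simp: card_gt_0_iff)
  moreover have "card (rcosets H) * card H = order G"
    by (rule lagrange[OF True])
  ultimately have "order G = card H * m \<longleftrightarrow> m = card (rcosets H)" for m
    by (metis mult.commute mult_cancel1 less_irrefl)
  moreover have "group (G\<lparr>carrier := H\<rparr>)"
    by (rule subgroup_imp_group[OF True])
  ultimately show ?thesis
    using True fin unfolding hall_subgroup_def pi_group_def by (auto simp: order_def)
qed (auto simp: hall_subgroup_def)

text \<open>The index has no prime divisor, hence equals 1.\<close>

lemma (in group) hall_subgroup_all_primes:
  assumes "finite (carrier G)" "\<And>p. prime p \<Longrightarrow> p \<in> \<pi>" "hall_subgroup \<pi> G H"
  shows "H = carrier G"
proof -
  obtain m where m: "subgroup H G" "order G = card H * m" "\<forall>p\<in>\<pi>. \<not> p dvd m"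
    using assms hall_subgroup_iff by blast
  have "m = 1"
    using m(3) assms(2) prime_factor_nat by blast
  then show ?thesis
    using m assms(1) by (simp add: card_subset_eq order_def subgroup.subset)
qed

subsection \<open>Transport along isomorphisms\<close>

lemma (in group_hom) conj_subgroup_img:
  assumes "A \<subseteq> carrier G" "g \<in> carrier G"
  shows "conj_subgroup H (h ` A) (h g) = h ` conj_subgroup G A g"
proof -
  have "inv\<^bsub>H\<^esub> h g \<otimes>\<^bsub>H\<^esub> h a \<otimes>\<^bsub>H\<^esub> h g = h (inv g \<otimes> a \<otimes> g)" if "a \<in> A" for a
    using assms that by (simp add: subset_iff)
  then show ?thesis
    unfolding conj_subgroup_def by (simp add: image_image)
qed

text \<open>A homomorphism sends conjugates to conjugates, and injectivity allows equal images of
  subsets to be cancelled.\<close>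

lemma (in group_hom) conjugate_in_img_iff:
  assumes "inj_on h (carrier G)" "M \<subseteq> carrier G" "A \<subseteq> carrier G" "B \<subseteq> carrier G"
  shows "conjugate_in H (h ` M) (h ` A) (h ` B) \<longleftrightarrow> conjugate_in G M A B"
proof -
  have "h ` B = conj_subgroup H (h ` A) (h x) \<longleftrightarrow> B = conj_subgroup G A x" if "x \<in> M" for x
  proof -
    have x: "x \<in> carrier G"
      using that assms by blast
    show ?thesis
      using conj_subgroup_img[OF assms(3) x] G.conj_subgroup_subset[OF assms(3) x]
        inj_on_image_eq_iff[OF assms(1,4)] by simp
  qed
  then show ?thesis
    unfolding conjugate_in_def by simp
qed

text \<open>Used in contrapositive form, to carry a failure of pronormality to an isomorphic copy.
  The image of a generated subgroup is generated by the images, so the conjugating element can be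
  pulled back.\<close>

lemma (in group_hom) pronormal_img:
  assumes "inj_on h (carrier G)" "subgroup A G" "pronormal H (h ` A)"
  shows "pronormal G A"
  unfolding pronormal_def
proof (intro conjI ballI)
  fix g assume g: "g \<in> carrier G"
  let ?B = "conj_subgroup G A g"
  have A: "A \<subseteq> carrier G"
    by (rule subgroup.subset[OF assms(2)])
  have B: "?B \<subseteq> carrier G"
    by (rule G.conj_subgroup_subset[OF A g])
  have "conjugate_in H (generate H (h ` A \<union> h ` ?B)) (h ` A) (h ` ?B)"
    using assms(3) hom_closed[OF g] unfolding pronormal_def conj_subgroup_img[OF A g, symmetric]
    by blast
  then have "conjugate_in H (h ` generate G (A \<union> ?B)) (h ` A) (h ` ?B)"
    using A B by (simp add: generate_img flip: image_Un)
  then show "conjugate_in G (generate G (A \<union> ?B)) A ?B"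
    using conjugate_in_img_iff[OF assms(1) _ A B] A B G.generate_incl by simp
qed (rule assms(2))

lemma (in group_hom) hall_subgroup_img:
  assumes "h \<in> iso G H" "finite (carrier G)" "hall_subgroup \<pi> G A"
  shows "hall_subgroup \<pi> H (h ` A)"
proof -
  have inj: "inj_on h (carrier G)" and img: "h ` carrier G = carrier H"
    using assms(1) by (auto simp: iso_def bij_betw_def)
  have A: "subgroup A G"
    using assms(3) by (simp add: hall_subgroup_def)
  have "card (h ` A) = card A"
    using inj A by (meson card_image inj_on_subset subgroup.subset)
  moreover have "order H = order G"
    unfolding order_def using card_image[OF inj] img by simp
  moreover have "finite (carrier H)"
    using assms(2) img by (metis finite_imageI)
  ultimately show ?thesis
    using assms(3) G.hall_subgroup_iff[OF assms(2)] H.hall_subgroup_iff subgroup_img_is_subgroup[OF A]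
    by simp
qed

lemma (in group) exists_iso_nat_group:
  assumes "finite (carrier G)"
  obtains M :: "nat monoid" and f where "group M" "f \<in> iso G M"
proof -
  obtain f :: "'a \<Rightarrow> nat" where "inj_on f (carrier G)"
    using assms finite_imp_inj_to_nat_seg by metis
  then show ?thesis
    using that inj_imp_image_group_iso inj_imp_image_group_is_group by blast
qed

subsection \<open>The wreath product with a cyclic group\<close>

text \<open>On residues mod \<open>n\<close>, \<open>n - a\<close> plays the role of
  \<open>-a\<close> without leaving the natural numbers; for \<open>a = 0\<close> it is
  \<open>n\<close>, which vanishes mod \<open>n\<close>.\<close>

lemma mod_shift_cancel:
  fixes i a n :: nat
  assumes "i < n" "a \<le> n"
  shows "((i + a) mod n + (n - a)) mod n = i" "((i + (n - a)) mod n + a) mod n = i"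
proof -
  have "((i + a) mod n + (n - a)) mod n = (i + a + (n - a)) mod n"
    by (rule mod_add_left_eq)
  also have "i + a + (n - a) = i + n"
    using assms by simp
  finally show "((i + a) mod n + (n - a)) mod n = i"
    using assms by simp
  have "((i + (n - a)) mod n + a) mod n = (i + (n - a) + a) mod n"
    by (rule mod_add_left_eq)
  also have "i + (n - a) + a = i + n"
    using assms by simp
  finally show "((i + (n - a)) mod n + a) mod n = i"
    using assms by simp
qed

text \<open>The semidirect product of the \<open>n\<close>-th power of \<open>X\<close> by the
  integers mod \<open>n\<close>, the shift acting on coordinates. Tuples are extensional functions,
  so that they are determined by their \<open>n\<close> coordinates and the carrier is finite when
  that of \<open>X\<close> is.\<close>

definition cyclic_wreath :: "('a, 'b) monoid_scheme \<Rightarrow> nat \<Rightarrow> ((nat \<Rightarrow> 'a) \<times> nat) monoid" where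
  "cyclic_wreath X n =
     \<lparr>carrier = (\<Pi>\<^sub>E i\<in>{..<n}. carrier X) \<times> {..<n},
      monoid.mult = (\<lambda>(f, a) (g, b). (\<lambda>i\<in>{..<n}. f i \<otimes>\<^bsub>X\<^esub> g ((i + a) mod n), (a + b) mod n)),
      one = (\<lambda>i\<in>{..<n}. \<one>\<^bsub>X\<^esub>, 0)\<rparr>"

definition base_prod :: "nat \<Rightarrow> (nat \<Rightarrow> 'a set) \<Rightarrow> ((nat \<Rightarrow> 'a) \<times> nat) set" where
  "base_prod n A = (\<Pi>\<^sub>E i\<in>{..<n}. A i) \<times> {0}"

lemma base_prod_eq_iff:
  assumes "\<And>i. i < n \<Longrightarrow> A i \<noteq> {}" "\<And>i. i < n \<Longrightarrow> B i \<noteq> {}"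
  shows "base_prod n A = base_prod n B \<longleftrightarrow> (\<forall>i<n. A i = B i)"
  using PiE_eq_iff_not_empty[of "{..<n}" A B] assms unfolding base_prod_def
  by (auto simp: times_eq_iff)

locale wreath = X: group X for X (structure) +
  fixes n :: nat
  assumes n_pos: "n > 0"
begin

abbreviation W where "W \<equiv> cyclic_wreath X n"

lemma W_carrier: "carrier W = (\<Pi>\<^sub>E i\<in>{..<n}. carrier X) \<times> {..<n}"
  by (simp add: cyclic_wreath_def)

lemma W_mult:
  "(f, a) \<otimes>\<^bsub>W\<^esub> (g, b) = (\<lambda>i\<in>{..<n}. f i \<otimes> g ((i + a) mod n), (a + b) mod n)"
  by (simp add: cyclic_wreath_def)

lemma W_one: "\<one>\<^bsub>W\<^esub> = (\<lambda>i\<in>{..<n}. \<one>, 0)"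
  by (simp add: cyclic_wreath_def)

lemma W_group: "group W"
proof (rule groupI)
  fix x y assume *: "x \<in> carrier W" "y \<in> carrier W"
  obtain f a g b where xy: "x = (f, a)" "y = (g, b)"
    by (metis surj_pair)
  show "x \<otimes>\<^bsub>W\<^esub> y \<in> carrier W"
    using * n_pos unfolding xy W_mult by (auto simp: W_carrier PiE_iff)
next
  fix x y z assume *: "x \<in> carrier W" "y \<in> carrier W" "z \<in> carrier W"
  obtain f a g b h c where xyz: "x = (f, a)" "y = (g, b)" "z = (h, c)"
    by (metis surj_pair)
  show "x \<otimes>\<^bsub>W\<^esub> y \<otimes>\<^bsub>W\<^esub> z = x \<otimes>\<^bsub>W\<^esub> (y \<otimes>\<^bsub>W\<^esub> z)"
    using * n_pos unfolding xyz W_mult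
    by (auto simp: W_carrier PiE_iff X.m_assoc mod_simps add.assoc intro!: restrict_ext)
next
  fix x assume *: "x \<in> carrier W"
  obtain f a where x: "x = (f, a)"
    by (metis surj_pair)
  show "\<one>\<^bsub>W\<^esub> \<otimes>\<^bsub>W\<^esub> x = x"
    using * unfolding x W_mult W_one
    by (auto simp: W_carrier PiE_iff extensional_def)
  \<comment> \<open>The outer \<open>mod\<close> matters for \<open>a = 0\<close>, where
    \<open>n - a\<close> is no valid shift. The tuple of \<open>?y\<close> is read off from the
    requirement that coordinate \<open>i\<close> of \<open>?y\<close> cancel \<open>f\<close> at
    \<open>i + ?b\<close>.\<close>
  let ?b = "(n - a) mod n"
  let ?y = "(\<lambda>i\<in>{..<n}. inv (f ((i + ?b) mod n)), ?b)"
  have "?y \<in> carrier W"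
    using * n_pos unfolding x by (auto simp: W_carrier PiE_iff)
  moreover have "?y \<otimes>\<^bsub>W\<^esub> x = \<one>\<^bsub>W\<^esub>"
    using * n_pos unfolding x W_mult W_one
    by (auto simp: W_carrier PiE_iff mod_simps intro!: restrict_ext)
  ultimately show "\<exists>y\<in>carrier W. y \<otimes>\<^bsub>W\<^esub> x = \<one>\<^bsub>W\<^esub>"
    by blast
qed (use n_pos in \<open>auto simp: W_carrier W_one\<close>)

sublocale W: group W
  by (rule W_group)

lemma W_finite:
  assumes "finite (carrier X)"
  shows "finite (carrier W)"
  using assms by (auto simp: W_carrier intro!: finite_PiE)

lemma W_order: "order W = order X ^ n * n"
  by (simp add: order_def W_carrier card_cartesian_product card_PiE)

section \<open>Products of subgroups in the base group, and their conjugates\<close>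

lemma base_mult:
  "(f, 0) \<otimes>\<^bsub>W\<^esub> (g, 0) = (\<lambda>i\<in>{..<n}. f i \<otimes> g i, 0)"
  by (auto simp: W_mult intro!: restrict_ext)

lemma base_inv:
  assumes "f \<in> (\<Pi>\<^sub>E i\<in>{..<n}. carrier X)"
  shows "inv\<^bsub>W\<^esub> (f, 0) = (\<lambda>i\<in>{..<n}. inv (f i), 0)"
proof (rule W.inv_equality)
  show "(\<lambda>i\<in>{..<n}. inv (f i), 0) \<otimes>\<^bsub>W\<^esub> (f, 0) = \<one>\<^bsub>W\<^esub>"
    using assms by (auto simp: W_mult W_one PiE_iff intro!: restrict_ext)
qed (use assms n_pos in \<open>auto simp: W_carrier PiE_iff\<close>)

lemma subgroup_base_prod:
  assumes "\<And>i. i < n \<Longrightarrow> subgroup (A i) X"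
  shows "subgroup (base_prod n A) W"
proof (rule W.subgroupI)
  have sub: "A i \<subseteq> carrier X" if "i < n" for i
    using assms[OF that] by (rule subgroup.subset)
  then have fX: "f \<in> (\<Pi>\<^sub>E i\<in>{..<n}. carrier X)" if "f \<in> (\<Pi>\<^sub>E i\<in>{..<n}. A i)" for f
    using that by (auto simp: PiE_iff)
  show "base_prod n A \<subseteq> carrier W"
    using fX n_pos by (auto simp: base_prod_def W_carrier)
  have "\<one>\<^bsub>W\<^esub> \<in> base_prod n A"
    using assms by (auto simp: base_prod_def W_one subgroup.one_closed)
  then show "base_prod n A \<noteq> {}"
    by blast
  show "inv\<^bsub>W\<^esub> x \<in> base_prod n A" if x: "x \<in> base_prod n A" for x
  proof -
    obtain f where f: "x = (f, 0)" "f \<in> (\<Pi>\<^sub>E i\<in>{..<n}. A i)"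
      using x by (auto simp: base_prod_def)
    then have "inv (f i) \<in> A i" if "i < n" for i
      using subgroup.m_inv_closed[OF assms[OF that]] that by auto
    then show ?thesis
      using f fX by (simp add: base_prod_def base_inv)
  qed
  show "x \<otimes>\<^bsub>W\<^esub> y \<in> base_prod n A" if xy: "x \<in> base_prod n A" "y \<in> base_prod n A" for x y
  proof -
    obtain f g where fg: "x = (f, 0)" "f \<in> (\<Pi>\<^sub>E i\<in>{..<n}. A i)"
        "y = (g, 0)" "g \<in> (\<Pi>\<^sub>E i\<in>{..<n}. A i)"
      using xy by (auto simp: base_prod_def)
    then have "f i \<otimes> g i \<in> A i" if "i < n" for i
      using subgroup.m_closed[OF assms[OF that]] that by auto
    then show ?thesis
      using fg by (simp add: base_prod_def base_mult)
  qed
qed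

text \<open>Comparing coordinates in
  \<open>(x, 0) \<otimes> (f, a) = (f, a) \<otimes> (y, 0)\<close> gives
  \<open>x i \<otimes> f i = f i \<otimes> y (i + a)\<close>, with \<open>i + a\<close> taken mod
  \<open>n\<close>. So the factor at \<open>i\<close> is conjugated by \<open>f i\<close> and moved
  to \<open>i + a\<close>.\<close>

lemma conj_base_prod:
  assumes A: "\<And>i. i < n \<Longrightarrow> A i \<subseteq> carrier X"
    and f: "f \<in> (\<Pi>\<^sub>E i\<in>{..<n}. carrier X)" and a: "a < n"
    and B: "\<And>i. i < n \<Longrightarrow> B ((i + a) mod n) = conj_subgroup X (A i) (f i)"
  shows "conj_subgroup W (base_prod n A) (f, a) = base_prod n B"
proof -
  have fa: "(f, a) \<in> carrier W"
    using f a by (simp add: W_carrier)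
  have fi: "f i \<in> carrier X" if "i < n" for i
    using f that by auto
  \<comment> \<open>The shift is onto, so the assumption on \<open>B\<close> determines all of its
    factors.\<close>
  have shift: "\<exists>i<n. (i + a) mod n = j" if "j < n" for j
  proof (intro exI conjI)
    show "(j + (n - a)) mod n < n"
      using n_pos by simp
    show "((j + (n - a)) mod n + a) mod n = j"
      using that a by (intro mod_shift_cancel) auto
  qed
  have conj_eq: "inv\<^bsub>W\<^esub> (f, a) \<otimes>\<^bsub>W\<^esub> (x, 0) \<otimes>\<^bsub>W\<^esub> (f, a) = (y, 0)"
    if x: "x \<in> (\<Pi>\<^sub>E i\<in>{..<n}. carrier X)" and y: "y \<in> (\<Pi>\<^sub>E i\<in>{..<n}. carrier X)"
      and xy: "\<And>i. i < n \<Longrightarrow> y ((i + a) mod n) = inv (f i) \<otimes> x i \<otimes> f i" for x y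
  proof -
    have "x i \<otimes> f i = f i \<otimes> y ((i + a) mod n)" if "i < n" for i
      using X.conj_eq_iff_commute[of "x i" "y ((i + a) mod n)" "f i"] x y fi xy that by auto
    then have "(x, 0) \<otimes>\<^bsub>W\<^esub> (f, a) = (f, a) \<otimes>\<^bsub>W\<^esub> (y, 0)"
      by (auto simp: W_mult intro!: restrict_ext)
    then show ?thesis
      using W.conj_eq_iff_commute[of "(x, 0)" "(y, 0)" "(f, a)"] x y fa n_pos
      by (simp add: W_carrier)
  qed
  have AX: "x \<in> (\<Pi>\<^sub>E i\<in>{..<n}. carrier X)" if "x \<in> (\<Pi>\<^sub>E i\<in>{..<n}. A i)" for x
    using that A by (auto simp: PiE_iff)
  have "B j \<subseteq> carrier X" if "j < n" for j
    using shift[OF that] B A fi X.conj_subgroup_subset by metis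
  then have BX: "y \<in> (\<Pi>\<^sub>E i\<in>{..<n}. carrier X)" if "y \<in> (\<Pi>\<^sub>E i\<in>{..<n}. B i)" for y
    using that by (auto simp: PiE_iff)
  show ?thesis
  proof (intro equalityI subsetI)
    fix z assume "z \<in> conj_subgroup W (base_prod n A) (f, a)"
    then obtain x where x: "x \<in> (\<Pi>\<^sub>E i\<in>{..<n}. A i)"
      and z: "z = inv\<^bsub>W\<^esub> (f, a) \<otimes>\<^bsub>W\<^esub> (x, 0) \<otimes>\<^bsub>W\<^esub> (f, a)"
      by (auto simp: conj_subgroup_def base_prod_def)
    \<comment> \<open>Coordinate \<open>j\<close> of the conjugate comes from coordinate
      \<open>j - a\<close> of \<open>x\<close>.\<close>
    define y where "y = (\<lambda>j\<in>{..<n}. let i = (j + (n - a)) mod n in inv (f i) \<otimes> x i \<otimes> f i)"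
    have xy: "y ((i + a) mod n) = inv (f i) \<otimes> x i \<otimes> f i" if "i < n" for i
    proof -
      have "((i + a) mod n + (n - a)) mod n = i"
        using that a by (intro mod_shift_cancel) auto
      then show ?thesis
        using n_pos by (simp add: y_def Let_def)
    qed
    have "y j \<in> B j" if "j < n" for j
      using shift[OF that] xy B x by (force simp: conj_subgroup_def)
    then have y: "y \<in> (\<Pi>\<^sub>E i\<in>{..<n}. B i)"
      by (auto simp: PiE_iff y_def)
    then show "z \<in> base_prod n B"
      using conj_eq[OF AX[OF x] BX[OF y] xy] z by (simp add: base_prod_def)
  next
    fix z assume "z \<in> base_prod n B"
    then obtain y where y: "y \<in> (\<Pi>\<^sub>E i\<in>{..<n}. B i)" and z: "z = (y, 0)"
      by (auto simp: base_prod_def)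
    have "\<exists>u. u \<in> A i \<and> y ((i + a) mod n) = inv (f i) \<otimes> u \<otimes> f i" if "i < n" for i
    proof -
      have "y ((i + a) mod n) \<in> B ((i + a) mod n)"
        using n_pos by (intro PiE_mem[OF y]) simp
      then show ?thesis
        using B[OF that] by (auto simp: conj_subgroup_def)
    qed
    then obtain u where u: "\<And>i. i < n \<Longrightarrow> u i \<in> A i \<and> y ((i + a) mod n) = inv (f i) \<otimes> u i \<otimes> f i"
      by metis
    \<comment> \<open>The chosen \<open>u\<close> is arbitrary beyond \<open>n\<close>; restricting
      makes it an extensional tuple.\<close>
    define x where "x = restrict u {..<n}"
    have x: "x \<in> (\<Pi>\<^sub>E i\<in>{..<n}. A i)"
      using u by (auto simp: x_def)
    have "inv\<^bsub>W\<^esub> (f, a) \<otimes>\<^bsub>W\<^esub> (x, 0) \<otimes>\<^bsub>W\<^esub> (f, a) = z"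
      using conj_eq[OF AX[OF x] BX[OF y]] u z by (simp add: x_def)
    then show "z \<in> conj_subgroup W (base_prod n A) (f, a)"
      using x by (force simp: conj_subgroup_def base_prod_def)
  qed
qed

text \<open>A product of nonempty sets determines its factors, so they can be compared with those
  computed in \<open>conj_base_prod\<close>.\<close>

lemma conj_base_prod_eqD:
  assumes A: "\<And>i. i < n \<Longrightarrow> A i \<subseteq> carrier X \<and> A i \<noteq> {}" and B: "\<And>i. i < n \<Longrightarrow> B i \<noteq> {}"
    and fa: "(f, a) \<in> carrier W"
    and eq: "base_prod n B = conj_subgroup W (base_prod n A) (f, a)"
    and i: "i < n"
  shows "B ((i + a) mod n) = conj_subgroup X (A i) (f i)"
proof -
  \<comment> \<open>The factors given by \<open>conj_base_prod\<close>, indexed by the target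
    \<open>j = i + a\<close> instead of the source \<open>i\<close>.\<close>
  define C where "C j = (let k = (j + (n - a)) mod n in conj_subgroup X (A k) (f k))" for j
  have f: "f \<in> (\<Pi>\<^sub>E i\<in>{..<n}. carrier X)" and a: "a < n"
    using fa by (auto simp: W_carrier)
  have C: "C ((k + a) mod n) = conj_subgroup X (A k) (f k)" if "k < n" for k
  proof -
    have "((k + a) mod n + (n - a)) mod n = k"
      using that a by (intro mod_shift_cancel) auto
    then show ?thesis
      by (simp add: C_def)
  qed
  have "base_prod n B = base_prod n C"
    using conj_base_prod[where B = C, OF _ f a C] A eq by simp
  moreover have "C j \<noteq> {}" if "j < n" for j
    using A n_pos by (simp add: C_def Let_def conj_subgroup_def)
  ultimately have "B j = C j" if "j < n" for j
    using base_prod_eq_iff[of n B C] B that by simp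
  then show ?thesis
    using C[OF i] n_pos by simp
qed

text \<open>The index in \<open>W\<close> is the product of the indices of the factors, times
  \<open>n\<close>. The extra factor is harmless because \<open>n\<close> is a prime outside
  \<open>\<pi>\<close>.\<close>

lemma hall_base_prod:
  assumes fin: "finite (carrier X)" and \<pi>: "\<forall>p\<in>\<pi>. prime p" and n: "prime n" "n \<notin> \<pi>"
    and A: "\<And>i. i < n \<Longrightarrow> hall_subgroup \<pi> X (A i)"
  shows "hall_subgroup \<pi> W (base_prod n A)"
  unfolding W.hall_subgroup_iff[OF W_finite[OF fin]]
proof (intro conjI)
  have A': "\<forall>i<n. subgroup (A i) X \<and> (\<forall>p. prime p \<and> p dvd card (A i) \<longrightarrow> p \<in> \<pi>) \<and>
              (\<exists>m. order X = card (A i) * m \<and> (\<forall>p\<in>\<pi>. \<not> p dvd m))"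
    using A X.hall_subgroup_iff[OF fin] by simp
  then obtain m where m: "\<And>i. i < n \<Longrightarrow> order X = card (A i) * m i \<and> (\<forall>p\<in>\<pi>. \<not> p dvd m i)"
    by metis
  have card: "card (base_prod n A) = (\<Prod>i<n. card (A i))"
    by (simp add: base_prod_def card_cartesian_product card_PiE)
  show "subgroup (base_prod n A) W"
    using A' by (simp add: subgroup_base_prod)
  show "\<forall>p. prime p \<and> p dvd card (base_prod n A) \<longrightarrow> p \<in> \<pi>"
    using A' by (auto simp: card prime_dvd_prod_iff)
  have "order W = (\<Prod>i<n. order X) * n"
    by (simp add: W_order)
  also have "(\<Prod>i<n. order X) = (\<Prod>i<n. card (A i) * m i)"
    using m by (intro prod.cong) auto
  finally have "order W = card (base_prod n A) * ((\<Prod>i<n. m i) * n)"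
    by (simp add: card prod.distrib)
  moreover have "\<not> p dvd (\<Prod>i<n. m i) * n" if "p \<in> \<pi>" for p
  proof
    assume "p dvd (\<Prod>i<n. m i) * n"
    moreover have p: "prime p"
      using \<pi> that by blast
    moreover have "\<not> p dvd n"
      using p n that primes_dvd_imp_eq by blast
    ultimately show False
      using m that by (auto simp: prime_dvd_mult_iff prime_dvd_prod_iff)
  qed
  ultimately show "\<exists>m. order W = card (base_prod n A) * m \<and> (\<forall>p\<in>\<pi>. \<not> p dvd m)"
    by blast
qed

text \<open>\<open>L\<close> is the subgroup that is not pronormal; \<open>M\<close> serves to keep
  \<open>W\<close> out of the class \<open>C_class \<pi>\<close>. Conjugacy is denied from
  \<open>M\<close> to \<open>L\<close> in this order because a conjugating element would then carry
  \<open>H\<close> to \<open>K\<close> in some coordinate, which is the direction of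
  \<open>not_conj\<close>.\<close>

lemma exists_nonpronormal_hall:
  assumes fin: "finite (carrier X)" and \<pi>: "\<forall>p\<in>\<pi>. prime p" and n: "prime n" "n \<notin> \<pi>"
    and H: "hall_subgroup \<pi> X H" and K: "hall_subgroup \<pi> X K"
    and not_conj: "\<not> conjugate_in X (carrier X) H K"
  obtains L M where "hall_subgroup \<pi> W L" "hall_subgroup \<pi> W M"
    "\<not> pronormal W L" "\<not> conjugate_in W (carrier W) M L"
proof -
  define A where "A i = (if i = 0 then H else K)" for i :: nat
  have n1: "1 < n"
    using n(1) prime_gt_1_nat by blast
  have "subgroup H X" "subgroup K X"
    using H K by (auto simp: hall_subgroup_def)
  then have HK: "H \<subseteq> carrier X" "H \<noteq> {}" "K \<subseteq> carrier X" "K \<noteq> {}"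
    by (auto simp: subgroup.subset dest: subgroup.one_closed)
  then have A: "A i \<subseteq> carrier X \<and> A i \<noteq> {}" for i
    by (simp add: A_def)
  have not_conj': "K \<noteq> conj_subgroup X H (f i)" if "(f, a) \<in> carrier W" "i < n" for f a i
    using not_conj that by (auto simp: conjugate_in_def W_carrier)
  let ?L = "base_prod n A" and ?M = "base_prod n (\<lambda>_. H)"
  have "hall_subgroup \<pi> W ?L" "hall_subgroup \<pi> W ?M"
    using hall_base_prod[OF fin \<pi> n] H K by (simp_all add: A_def)
  moreover have "\<not> conjugate_in W (carrier W) ?M ?L"
  proof
    assume "conjugate_in W (carrier W) ?M ?L"
    then obtain f a where fa: "(f, a) \<in> carrier W" and eq: "?L = conj_subgroup W ?M (f, a)"
      unfolding conjugate_in_def by auto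
    \<comment> \<open>The coordinate that the shift by \<open>a\<close> moves to 1, where
      \<open>L\<close> has the factor \<open>K\<close>; coordinate 1 exists since
      \<open>n > 1\<close>.\<close>
    let ?i = "(1 + (n - a)) mod n"
    have i: "?i < n" "(?i + a) mod n = 1"
      using n1 fa mod_shift_cancel(2)[of 1 n a] by (auto simp: W_carrier)
    have "A ((?i + a) mod n) = conj_subgroup X H (f ?i)"
      using conj_base_prod_eqD[OF _ _ fa eq i(1)] A HK by blast
    then show False
      using not_conj'[OF fa i(1)] i(2) by (simp add: A_def)
  qed
  moreover have "\<not> pronormal W ?L"
  proof
    assume pron: "pronormal W ?L"
    let ?g = "(\<lambda>i\<in>{..<n}. \<one>, 1)"
    \<comment> \<open>\<open>?g\<close> is the pure shift by one and \<open>n - 1\<close> stands for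
      \<open>-1\<close>, so \<open>B\<close> is \<open>A\<close> moved one place on.\<close>
    define B where "B j = A ((j + (n - 1)) mod n)" for j
    have g: "?g \<in> carrier W"
      using n1 by (auto simp: W_carrier)
    have "B ((i + 1) mod n) = conj_subgroup X (A i) \<one>" if "i < n" for i
    proof -
      have "((i + 1) mod n + (n - 1)) mod n = i"
        using that n1 by (intro mod_shift_cancel) auto
      then show ?thesis
        using A by (simp add: B_def X.conj_subgroup_one)
    qed
    then have Lg: "conj_subgroup W ?L ?g = base_prod n B"
      using conj_base_prod[of A "\<lambda>i\<in>{..<n}. \<one>" 1 B] A n1 by simp
    \<comment> \<open>The base group contains both subgroups, hence all they generate. A conjugating
      element therefore has shift 0 and must match the factors at equal coordinates.\<close>
    let ?X = "base_prod n (\<lambda>_. carrier X)"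
    have X: "subgroup ?X W"
      by (simp add: subgroup_base_prod X.subgroup_self)
    have "?L \<union> base_prod n B \<subseteq> ?X"
      using A by (auto simp: base_prod_def B_def PiE_iff subset_iff)
    then have "generate W (?L \<union> base_prod n B) \<subseteq> ?X"
      using W.generate_subgroup_incl X by blast
    moreover have "conjugate_in W (generate W (?L \<union> base_prod n B)) ?L (base_prod n B)"
      using pron g Lg unfolding pronormal_def by metis
    ultimately obtain f where f: "(f, 0) \<in> ?X"
      and eq: "base_prod n B = conj_subgroup W ?L (f, 0)"
      unfolding conjugate_in_def by (auto simp: base_prod_def)
    have fW: "(f, 0) \<in> carrier W"
      using f subgroup.subset[OF X] by blast
    have "B ((0 + 0) mod n) = conj_subgroup X (A 0) (f 0)"
      using conj_base_prod_eqD[OF _ _ fW eq n_pos] A by (simp add: B_def)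
    \<comment> \<open>\<open>B 0\<close> is \<open>A (n - 1)\<close>, and \<open>n - 1\<close> is
      nonzero, whereas \<open>A 0 = H\<close>.\<close>
    moreover have "B 0 = K"
      using n1 by (simp add: B_def A_def)
    ultimately show False
      using not_conj'[OF fW n_pos] by (simp add: A_def)
  qed
  ultimately show ?thesis
    using that by blast
qed

end

section \<open>Choice of the prime and passage to a group of natural numbers\<close>

theorem theorem3:
  fixes \<pi> :: "nat set"
  assumes "\<forall>p\<in>\<pi>. prime p"
    and "(E_class \<pi> - C_class \<pi> :: 'a monoid set) \<noteq> {}"
  shows "\<exists>G \<in> (E_class \<pi> - C_class \<pi> :: nat monoid set).
           \<exists>H. hall_subgroup \<pi> G H \<and> \<not> pronormal G H"
proof -
  obtain X :: "'a monoid" and H K where X: "group X" "finite (carrier X)"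
    and H: "hall_subgroup \<pi> X H" and K: "hall_subgroup \<pi> X K"
    and not_conj: "\<not> conjugate_in X (carrier X) H K"
    using assms(2) unfolding C_class_def E_class_def by blast
  interpret X: group X by (rule X(1))
  obtain p where p: "prime p" "p \<notin> \<pi>"
  proof (rule ccontr)
    assume "\<not> thesis"
    then have all: "\<And>p. prime p \<Longrightarrow> p \<in> \<pi>"
      using that by blast
    have "H = carrier X" "K = carrier X"
      using X.hall_subgroup_all_primes[OF X(2) all] H K by blast+
    then show False
      using not_conj X.conj_subgroup_one[of "carrier X"] unfolding conjugate_in_def by fastforce
  qed
  interpret wreath X p
    by unfold_locales (rule prime_gt_0_nat[OF p(1)])
  obtain L M where L: "hall_subgroup \<pi> W L" and M: "hall_subgroup \<pi> W M"
    and nonpron: "\<not> pronormal W L" and LM: "\<not> conjugate_in W (carrier W) M L"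
    using exists_nonpronormal_hall[OF X(2) assms(1) p H K not_conj] .
  have finW: "finite (carrier W)"
    by (rule W_finite[OF X(2)])
  \<comment> \<open>Elements of \<open>W\<close> are pairs of a tuple and a shift, while the goal
    asks for a group on \<open>nat\<close>; an isomorphic copy carries over both failures of
    conjugacy.\<close>
  obtain G :: "nat monoid" and \<phi> where G: "group G" and \<phi>: "\<phi> \<in> iso W G"
    using W.exists_iso_nat_group[OF finW] .
  interpret \<phi>: group_hom W G \<phi>
    using G \<phi> by (simp add: group_hom_def group_hom_axioms_def iso_def W_group)
  have inj: "inj_on \<phi> (carrier W)" and img: "\<phi> ` carrier W = carrier G"
    using \<phi> by (auto simp: iso_def bij_betw_def)
  have sub: "subgroup L W" "subgroup M W"
    using L M by (auto simp: hall_subgroup_def)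
  have hall: "hall_subgroup \<pi> G (\<phi> ` L)" "hall_subgroup \<pi> G (\<phi> ` M)"
    using \<phi>.hall_subgroup_img[OF \<phi> finW] L M by blast+
  have "finite (carrier G)"
    using finW img by (metis finite_imageI)
  moreover have "\<not> conjugate_in G (carrier G) (\<phi> ` M) (\<phi> ` L)"
    using \<phi>.conjugate_in_img_iff[OF inj order.refl, of M L] LM sub img
    by (simp add: subgroup.subset)
  ultimately have "G \<in> E_class \<pi> - C_class \<pi>"
    using G hall unfolding E_class_def C_class_def by blast
  moreover have "\<not> pronormal G (\<phi> ` L)"
    using \<phi>.pronormal_img[OF inj sub(1)] nonpron by blast
  ultimately show ?thesis
    using hall(1) by blast
qed

end
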